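(* For any positive integers $m$ and $n$, $\operatorname{ept}(K_{m,n})=O(\log(m+n))$; that is, there is an absolute constant $C>0$ such that $\operatorname{ept}(K_{m,n})\le C\log(m+n)$ for all positive integers $m,n$. For a fixed positive integer $c$, $\operatorname{ept}(K_{c,n})=\Theta(\log n)$ as $n\to\infty$; that is, there exist constants $c_1,c_2>0$ and $n_0$, depending only on $c$, such that $c_1\log n\le \operatorname{ept}(K_{c,n})\le c_2\log n$ for all $n\ge n_0$.
   Context: Graphs are finite, simple and undirected. $K_{m,n}$ is the complete bipartite graph with partite sets of orders $m$ and $n$. $N[u]=N(u)\cup\{u\}$ is the closed neighborhood of $u$. Probabilistic zero forcing: each vertex of a connected graph $G$ is blue or white. In one round, with $C$ the set of vertices that are blue at the start of the round, every blue vertex $u$ attempts to force each of its white neighbors $w$, all attempts being independent, each succeeding with probability $\Pr(u\to w)=\frac{|N[u]\cap C|}{\deg u}$. A white vertex becomes blue in the round if at least one blue neighbor succeeds in forcing it; blue vertices stay blue. For a nonempty set $B$ of vertices, $\operatorname{pt}_{pzf}(G,B)$ is the random number of the round in which the last white vertex turns blue when initially exactly the vertices in $B$ are blue (it is $0$ if $B=V(G)$), and $\operatorname{ept}(G,B)=\mathbf{E}[\operatorname{pt}_{pzf}(G,B)]$. The expected propagation time of $G$ is $\operatorname{ept}(G)=\min\{\operatorname{ept}(G,\{v\}):v\in V(G)\}$. *)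

theory Defs
  imports "HOL-Probability.Probability" "Graph_Theory.Graph_Theory"
begin

text \<open>
  As in the library, a finite simple undirected graph is a symmetric digraph satisfying the
  locale \<^locale>\<open>graph\<close>.
\<close>

definition nbrs :: "('a, 'b) pre_digraph \<Rightarrow> 'a \<Rightarrow> 'a set" where
  "nbrs G u = {w. u \<rightarrow>\<^bsub>G\<^esub> w}"

definition closed_nbrs :: "('a, 'b) pre_digraph \<Rightarrow> 'a \<Rightarrow> 'a set" where
  "closed_nbrs G u = nbrs G u \<union> {u}"

lemma (in graph) out_degree_eq_card_nbrs: "out_degree G u = card (nbrs G u)"
proof -
  have "bij_betw (head G) (out_arcs G u) (nbrs G u)"
    unfolding bij_betw_def
  proof
    show "inj_on (head G) (out_arcs G u)"
      by (rule inj_onI) (auto intro!: no_multi_arcs simp: arc_to_ends_def)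
    show "head G ` out_arcs G u = nbrs G u"
      by (auto simp: nbrs_def arcs_ends_conv)
  qed
  then show ?thesis
    unfolding out_degree_def by (rule bij_betw_same_card)
qed

text \<open>\<open>C\<close> is always the set of vertices that are blue at the start of the round.\<close>

definition force_prob :: "('a, 'b) pre_digraph \<Rightarrow> 'a set \<Rightarrow> 'a \<Rightarrow> real" where
  "force_prob G C u = real (card (closed_nbrs G u \<inter> C)) / real (out_degree G u)"

definition attempts :: "('a, 'b) pre_digraph \<Rightarrow> 'a set \<Rightarrow> ('a \<times> 'a) set" where
  "attempts G C = {(u, w). u \<in> C \<and> w \<notin> C \<and> u \<rightarrow>\<^bsub>G\<^esub> w}"

lemma (in graph) force_prob_bounds:
  assumes "(u, w) \<in> attempts G C"
  shows "0 \<le> force_prob G C u" "force_prob G C u \<le> 1"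
proof -
  have w: "w \<in> nbrs G u" "w \<notin> C" "u \<in> C" and u: "u \<notin> nbrs G u"
    using assms adj_not_same by (auto simp: attempts_def nbrs_def)
  have fin: "finite (nbrs G u)"
    by (rule finite_subset[OF _ finite_verts]) (auto simp: nbrs_def dest: adj_in_verts)
  have "card (closed_nbrs G u \<inter> C) \<le> card (insert u (nbrs G u - {w}))"
    using w fin by (intro card_mono) (auto simp: closed_nbrs_def)
  also have "\<dots> = card (nbrs G u)"
    using w u fin card.remove[OF fin, of w] by simp
  finally show "force_prob G C u \<le> 1"
    by (auto simp: force_prob_def out_degree_eq_card_nbrs divide_le_eq_1)
qed (simp add: force_prob_def)

text \<open>
  In every round there is one Boolean for each potential attempt \<open>(C, u, w)\<close>: whether \<open>u\<close>
  succeeds in forcing \<open>w\<close> in that round, provided that \<open>C\<close> is the set of blue vertices at its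
  start. All these Booleans are independent, within a round and between rounds. Only those
  belonging to the actual blue set are looked at, so the evolution is a Markov chain in which, given
  the past, the attempts of a round are independent with success probabilities
  \<^const>\<open>force_prob\<close>; the joint law for different \<open>C\<close> within a round is irrelevant.
\<close>

type_synonym 'a outcomes = "'a set \<times> 'a \<times> 'a \<Rightarrow> bool"

definition pzf_round :: "('a, 'b) pre_digraph \<Rightarrow> 'a outcomes pmf" where
  "pzf_round G =
     Pi_pmf (SIGMA C : Pow (verts G). attempts G C) False
       (\<lambda>(C, u, w). bernoulli_pmf (force_prob G C u))"

definition pzf_space :: "('a, 'b) pre_digraph \<Rightarrow> 'a outcomes stream measure" where
  "pzf_space G = stream_space (measure_pmf (pzf_round G))"

definition blue_step :: "('a, 'b) pre_digraph \<Rightarrow> 'a outcomes \<Rightarrow> 'a set \<Rightarrow> 'a set" where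
  "blue_step G succeeds C = C \<union> {w. \<exists>u. (u, w) \<in> attempts G C \<and> succeeds (C, u, w)}"

primrec blue :: "('a, 'b) pre_digraph \<Rightarrow> 'a set \<Rightarrow> 'a outcomes stream \<Rightarrow> nat \<Rightarrow> 'a set" where
  "blue G B \<omega> 0 = B"
| "blue G B \<omega> (Suc t) = blue_step G (\<omega> !! t) (blue G B \<omega> t)"

text \<open>The infimum is \<open>\<infinity>\<close> if some vertex stays white forever.\<close>

definition pt_pzf :: "('a, 'b) pre_digraph \<Rightarrow> 'a set \<Rightarrow> 'a outcomes stream \<Rightarrow> ennreal" where
  "pt_pzf G B \<omega> = (INF t \<in> {t. blue G B \<omega> t = verts G}. of_nat t)"

context fin_digraph
begin

lemma blue_subset_verts: "B \<subseteq> verts G \<Longrightarrow> blue G B \<omega> t \<subseteq> verts G"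
  by (induction t) (auto simp: blue_step_def attempts_def dest: adj_in_verts)

lemma measurable_blue:
  assumes "B \<subseteq> verts G"
  shows "(\<lambda>\<omega>. blue G B \<omega> t) \<in> measurable (pzf_space G) (count_space (Pow (verts G)))"
proof (induction t)
  case 0
  then show ?case using assms by simp
next
  case (Suc t)
  have "(\<lambda>\<omega>. blue_step G (\<omega> !! t) C) \<in> measurable (pzf_space G) (count_space (Pow (verts G)))"
    if "C \<in> Pow (verts G)" for C
  proof -
    have "(\<lambda>f. blue_step G f C)
        \<in> measurable (measure_pmf (pzf_round G)) (count_space (Pow (verts G)))"
      using that by (auto simp: blue_step_def attempts_def dest: adj_in_verts)
    from measurable_compose[OF measurable_snth this] show ?thesis
      by (simp add: pzf_space_def)
  qed
  then have "(\<lambda>\<omega>. (\<lambda>C \<omega>. blue_step G (\<omega> !! t) C) (blue G B \<omega> t) \<omega>)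
      \<in> measurable (pzf_space G) (count_space (Pow (verts G)))"
    by (rule measurable_compose_countable'[OF _ Suc.IH]) (simp_all add: countable_finite)
  then show ?case by simp
qed

lemma measurable_pt_pzf:
  assumes "B \<subseteq> verts G"
  shows "pt_pzf G B \<in> borel_measurable (pzf_space G)"
proof -
  have eq: "pt_pzf G B \<omega> = (INF t. if blue G B \<omega> t = verts G then of_nat t else \<infinity>)" for \<omega>
    unfolding pt_pzf_def
  proof (rule antisym)
    show "(INF t \<in> {t. blue G B \<omega> t = verts G}. of_nat t)
        \<le> (INF t. if blue G B \<omega> t = verts G then of_nat t else \<infinity> :: ennreal)"
      by (rule INF_greatest) (simp add: INF_lower)
    show "(INF t. if blue G B \<omega> t = verts G then of_nat t else \<infinity> :: ennreal)
        \<le> (INF t \<in> {t. blue G B \<omega> t = verts G}. of_nat t)"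
    proof (rule INF_greatest)
      fix t assume "t \<in> {t. blue G B \<omega> t = verts G}"
      then show "(INF t. if blue G B \<omega> t = verts G then of_nat t else \<infinity> :: ennreal) \<le> of_nat t"
        by (intro INF_lower2[of t]) simp_all
    qed
  qed
  have "(\<lambda>\<omega>. if blue G B \<omega> t = verts G then of_nat t else \<infinity> :: ennreal)
      \<in> borel_measurable (pzf_space G)" for t
    by (rule measurable_compose[OF measurable_blue[OF assms, of t]]) simp
  then show ?thesis
    unfolding fun_eq_iff[THEN iffD2, OF allI, OF eq]
    by (intro borel_measurable_INF) simp_all
qed

end

definition ept_from :: "('a, 'b) pre_digraph \<Rightarrow> 'a set \<Rightarrow> ennreal" where
  "ept_from G B = (\<integral>\<^sup>+ \<omega>. pt_pzf G B \<omega> \<partial>pzf_space G)"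

definition ept :: "('a, 'b) pre_digraph \<Rightarrow> ennreal" where
  "ept G = (MIN v \<in> verts G. ept_from G {v})"

definition complete_bipartite :: "nat \<Rightarrow> nat \<Rightarrow> (nat + nat, (nat + nat) \<times> (nat + nat)) pre_digraph"
  where "complete_bipartite m n =
    (let U = Inl ` {..<m}; V = Inr ` {..<n}
     in with_proj \<lparr>pverts = U \<union> V, parcs = U \<times> V \<union> V \<times> U\<rparr>)"

lemma complete_bipartite_digraph_complete_bipartite:
  "complete_bipartite_digraph m n (complete_bipartite m n)"
  unfolding complete_bipartite_def Let_def complete_bipartite_digraph_pair_def
  by (intro conjI exI[of _ "Inl ` {..<m}"] exI[of _ "Inr ` {..<n}"])
     (auto simp: card_image)

end

theory Submission
  imports Defs
begin

text \<open>
  Let \<open>A\<close>, \<open>B\<close> be the two parts, \<open>m = card A\<close>, \<open>n = card B\<close>, and let \<open>j\<close> be the number of blue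
  vertices of \<open>B\<close>.

  Upper bound: let \<open>m \<le> n\<close> and start at a vertex of \<open>A\<close>. Its attempts alone turn each white vertex of
  \<open>B\<close> blue with probability \<open>(1 + j) / n\<close>, which makes \<open>\<Psi> = (n + 1) (n - j) / (1 + j)\<close> shrink in
  expectation by a factor \<open>3/4\<close> per round, uniformly from \<open>j = 0\<close> to \<open>j = n\<close>. Once \<open>B\<close> is blue, every
  white vertex of \<open>A\<close> survives a round with probability at most \<open>(1 - 1/m)\<^sup>n \<le> 1/e\<close>. Hence
  \<open>m \<Psi> +\<close> (number of white vertices in \<open>A\<close>) shrinks by a factor \<open>7/8\<close>; it is \<open>0\<close> or at least \<open>1\<close>,
  and initially polynomial in \<open>m + n\<close>, so it vanishes after \<open>O(ln (m + n))\<close> expected rounds.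

  Lower bound: in one round \<open>1 + j\<close> grows in expectation at most by the factor \<open>1 + m\<close>, so by Markov's
  inequality \<open>B\<close> is still not entirely blue with probability at least \<open>1/2\<close> after a number of rounds
  of order \<open>ln n / ln (1 + m)\<close>.
\<close>

section \<open>Restarting the process after its first round\<close>

context fin_digraph
begin

lemma blue_step_subset_verts: "C \<subseteq> verts G \<Longrightarrow> blue_step G x C \<subseteq> verts G"
  by (auto simp: blue_step_def attempts_def dest: adj_in_verts)

lemma blue_step_verts: "blue_step G x (verts G) = verts G"
  by (auto simp: blue_step_def attempts_def dest: adj_in_verts)

lemma blue_verts: "blue G (verts G) \<omega> t = verts G"
  by (induction t) (simp_all add: blue_step_verts)

lemma blue_Stream: "blue G B (x ## \<omega>) (Suc t) = blue G (blue_step G x B) \<omega> t"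
  by (induction t) simp_all

lemma blue_eq_verts_mono:
  assumes "blue G B \<omega> s = verts G" "s \<le> t"
  shows "blue G B \<omega> t = verts G"
  using assms(2,1) by (induction rule: dec_induct) (simp_all add: blue_step_verts)

lemma measurable_of_blue:
  assumes "B \<subseteq> verts G"
  shows "(\<lambda>\<omega>. h (blue G B \<omega> t) :: ennreal) \<in> borel_measurable (pzf_space G)"
  by (rule measurable_compose[OF measurable_blue[OF assms]]) simp

lemma prob_space_pzf_space: "prob_space (pzf_space G)"
  unfolding pzf_space_def
  by (rule prob_space.prob_space_stream_space[OF prob_space_measure_pmf])

lemmas emeasure_space_pzf_space = prob_space.emeasure_space_1[OF prob_space_pzf_space]

text \<open>Markov property: the first outcome fixes the next blue set, and the rest of the stream
  is independent of it and again distributed as \<open>pzf_space G\<close>.\<close>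

lemma nn_integral_blue_Suc:
  assumes "B \<subseteq> verts G"
  shows "(\<integral>\<^sup>+ \<omega>. h (blue G B \<omega> (Suc t)) \<partial>pzf_space G) =
    (\<integral>\<^sup>+ x. (\<integral>\<^sup>+ \<omega>. h (blue G (blue_step G x B) \<omega> t) \<partial>pzf_space G) \<partial>pzf_round G)"
  using prob_space.nn_integral_stream_space[
      OF prob_space_measure_pmf measurable_of_blue[OF assms, unfolded pzf_space_def],
      of h "Suc t"]
  by (simp only: blue_Stream flip: pzf_space_def)

section \<open>Bounding the expected propagation time by one-round estimates\<close>

lemma pt_pzf_le_suminf:
  "pt_pzf G B \<omega> \<le> (\<Sum>t. of_bool (blue G B \<omega> t \<noteq> verts G))"
proof (cases "\<exists>t. blue G B \<omega> t = verts G")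
  case True
  define T where "T = (LEAST t. blue G B \<omega> t = verts G)"
  have T: "blue G B \<omega> T = verts G" unfolding T_def using True by (rule LeastI_ex)
  have "pt_pzf G B \<omega> \<le> of_nat T"
    unfolding pt_pzf_def using T by (intro INF_lower) simp
  also have "\<dots> = (\<Sum>t<T. of_bool (blue G B \<omega> t \<noteq> verts G) :: ennreal)"
    by (subst sum.cong[of _ "{..<T}" _ "\<lambda>_. 1"]) (auto simp: T_def dest: not_less_Least)
  also have "\<dots> \<le> (\<Sum>t. of_bool (blue G B \<omega> t \<noteq> verts G))"
    by (rule sum_le_suminf) auto
  finally show ?thesis .
next
  case False
  have "(\<Sum>t. 1 :: ennreal) = \<infinity>"
    by (simp add: suminf_eq_SUP ennreal_SUP_of_nat_eq_top)
  with False show ?thesis by simp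
qed

text \<open>Once all vertices are blue they stay so, hence every completion time is at least
  \<open>Suc t\<close>. If there is none, the infimum is infinite.\<close>

lemma pt_pzf_ge:
  assumes "blue G B \<omega> t \<noteq> verts G"
  shows "of_nat (Suc t) \<le> pt_pzf G B \<omega>"
  unfolding pt_pzf_def
proof (rule INF_greatest)
  fix s assume "s \<in> {s. blue G B \<omega> s = verts G}"
  then have "\<not> s \<le> t" using blue_eq_verts_mono[of B \<omega> s t] assms by blast
  then have "Suc t \<le> s" by simp
  then show "of_nat (Suc t) \<le> (of_nat s :: ennreal)" by (simp only: of_nat_le_iff)
qed

text \<open>Lyapunov criterion: a nonnegative \<open>f\<close> that drops by at least 1 in
  expectation per round dominates the expected number of rounds. Blue sets only grow, so the
  condition is asked only for supersets of \<open>B\<close>.\<close>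

lemma ept_from_le_supersolution:
  fixes f :: "'a set \<Rightarrow> ennreal"
  assumes B: "B \<subseteq> verts G"
    and f: "\<And>C. B \<subseteq> C \<Longrightarrow> C \<subset> verts G \<Longrightarrow>
      1 + (\<integral>\<^sup>+ x. f (blue_step G x C) \<partial>pzf_round G) \<le> f C"
  shows "ept_from G B \<le> f B"
proof -
  define w where "w C t = (\<integral>\<^sup>+ \<omega>. of_bool (blue G C \<omega> t \<noteq> verts G) \<partial>pzf_space G)" for C t
  have w_Suc: "w C (Suc t) = (\<integral>\<^sup>+ x. w (blue_step G x C) t \<partial>pzf_round G)" if "C \<subseteq> verts G" for C t
    unfolding w_def using nn_integral_blue_Suc[OF that, of "\<lambda>C. of_bool (C \<noteq> verts G)"] by simp
  \<comment> \<open>Here \<open>w C t\<close> is the probability that the process started from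
    \<open>C\<close> is unfinished at time \<open>t\<close>. The induction needs all
    \<open>C\<close> at once, because the first round replaces the starting set.\<close>
  have "(\<Sum>t<N. w C t) \<le> f C" if "B \<subseteq> C" "C \<subseteq> verts G" for N C
    using that
  proof (induction N arbitrary: C)
    case 0
    then show ?case by simp
  next
    case (Suc N)
    show ?case
    proof (cases "C = verts G")
      case True
      then show ?thesis by (simp add: w_def blue_verts)
    next
      case False
      have "(\<Sum>t<Suc N. w C t) = w C 0 + (\<Sum>t<N. w C (Suc t))"
        by (rule sum.lessThan_Suc_shift)
      also have "w C 0 = 1"
        using False by (simp add: w_def emeasure_space_pzf_space)
      also have "(\<Sum>t<N. w C (Suc t)) = (\<integral>\<^sup>+ x. (\<Sum>t<N. w (blue_step G x C) t) \<partial>pzf_round G)"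
        using Suc.prems by (simp add: w_Suc nn_integral_sum)
      also have "1 + \<dots> \<le> 1 + (\<integral>\<^sup>+ x. f (blue_step G x C) \<partial>pzf_round G)"
        using Suc.prems
        by (intro add_left_mono nn_integral_mono Suc.IH blue_step_subset_verts)
           (auto simp: blue_step_def)
      also have "\<dots> \<le> f C" using Suc.prems False by (intro f) auto
      finally show ?thesis .
    qed
  qed
  then have "(\<Sum>t. w B t) \<le> f B"
    unfolding suminf_eq_SUP using B by (blast intro: SUP_least)
  moreover have "ept_from G B \<le> (\<Sum>t. w B t)"
  proof -
    have "ept_from G B \<le> (\<integral>\<^sup>+ \<omega>. (\<Sum>t. of_bool (blue G B \<omega> t \<noteq> verts G)) \<partial>pzf_space G)"
      unfolding ept_from_def by (intro nn_integral_mono pt_pzf_le_suminf)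
    also have "\<dots> = (\<Sum>t. w B t)"
      unfolding w_def
      by (rule nn_integral_suminf) (rule measurable_of_blue[OF B, of "\<lambda>C. of_bool (C \<noteq> verts G)"])
    finally show ?thesis .
  qed
  ultimately show ?thesis by simp
qed

lemma finite_attempts: "finite (attempts G C)"
  by (rule finite_subset[of _ "verts G \<times> verts G"]) (auto simp: attempts_def dest: adj_in_verts)

lemma finite_all_attempts: "finite (SIGMA C : Pow (verts G). attempts G C)"
  by (intro finite_SigmaI finite_attempts) simp

text \<open>Finite support makes every real function of one round integrable, so linearity of
  expectation applies freely below.\<close>

lemma finite_set_pzf_round: "finite (set_pmf (pzf_round G))"
proof -
  have "finite (PiE_dflt (SIGMA C : Pow (verts G). attempts G C) False (\<lambda>_. UNIV :: bool set))"
    by (intro finite_PiE_dflt finite_all_attempts) simp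
  then show ?thesis
    unfolding pzf_round_def set_Pi_pmf[OF finite_all_attempts]
    by (rule rev_finite_subset) (auto simp: PiE_dflt_def)
qed

lemma integrable_pzf_round [simp]:
  fixes f :: "_ \<Rightarrow> real"
  shows "integrable (measure_pmf (pzf_round G)) f"
  by (rule integrable_measure_pmf_finite[OF finite_set_pzf_round])

text \<open>A potential that shrinks by a constant factor in expectation has a logarithm that drops
  by a constant, so \<open>(1 + ln \<Phi>) / \<delta>\<close> serves as supersolution.\<close>

lemma ept_from_le_multiplicative_drift:
  fixes \<Phi> :: "'a set \<Rightarrow> real"
  assumes B: "B \<subseteq> verts G" and \<delta>: "\<delta> > 0"
    and range: "\<And>C. C \<subseteq> verts G \<Longrightarrow> \<Phi> C = 0 \<or> 1 \<le> \<Phi> C"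
    and pos: "\<And>C. C \<subset> verts G \<Longrightarrow> \<Phi> C \<noteq> 0"
    and drift: "\<And>C. B \<subseteq> C \<Longrightarrow> C \<subset> verts G \<Longrightarrow>
      measure_pmf.expectation (pzf_round G) (\<lambda>x. \<Phi> (blue_step G x C)) \<le> (1 - \<delta>) * \<Phi> C"
  shows "ept_from G B \<le> ennreal ((1 + ln (\<Phi> B)) / \<delta>)"
proof -
  \<comment> \<open>The summand 1 pays for the final jump of \<open>\<Phi>\<close> from a value of
    at least 1 down to 0, where \<open>f\<close> is set to 0.\<close>
  define f where "f C = (if \<Phi> C = 0 then 0 else (1 + ln (\<Phi> C)) / \<delta>)" for C
  have f_nonneg: "0 \<le> f C" if "C \<subseteq> verts G" for C
    using range[OF that] \<delta> by (auto simp: f_def)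
  have "ept_from G B \<le> ennreal (f B)"
  proof (rule ept_from_le_supersolution[OF B])
    fix C assume C: "B \<subseteq> C" "C \<subset> verts G"
    have \<Phi>C: "1 \<le> \<Phi> C" using range[of C] pos[of C] C by auto
    \<comment> \<open>By concavity of \<open>ln\<close>, \<open>f\<close> lies below its tangent at
      \<open>\<Phi> C\<close>. At potential 0 the tangent has height
      \<open>ln (\<Phi> C) / \<delta>\<close>, which is nonnegative since
      \<open>\<Phi> C \<ge> 1\<close>. The bound is linear in \<open>\<Phi> D\<close>, so the drift
      hypothesis can be inserted.\<close>
    have tangent: "f D \<le> f C + (\<Phi> D - \<Phi> C) / (\<delta> * \<Phi> C)" if "D \<subseteq> verts G" for D
    proof (cases "\<Phi> D = 0")
      case True
      then show ?thesis using \<Phi>C \<delta> by (simp add: f_def field_simps)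
    next
      case False
      with range[OF that] have "1 \<le> \<Phi> D" by auto
      then have "ln (\<Phi> D) - ln (\<Phi> C) \<le> \<Phi> D / \<Phi> C - 1"
        using \<Phi>C ln_le_minus_one[of "\<Phi> D / \<Phi> C"] by (simp add: ln_div)
      then have "ln (\<Phi> D) \<le> ln (\<Phi> C) + (\<Phi> D - \<Phi> C) / \<Phi> C"
        using \<Phi>C by (simp add: diff_divide_distrib)
      then have "(1 + ln (\<Phi> D)) / \<delta> \<le> (1 + ln (\<Phi> C) + (\<Phi> D - \<Phi> C) / \<Phi> C) / \<delta>"
        using \<delta> by (intro divide_right_mono) auto
      also have "\<dots> = (1 + ln (\<Phi> C)) / \<delta> + (\<Phi> D - \<Phi> C) / (\<delta> * \<Phi> C)"
        by (simp add: add_divide_distrib mult.commute)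
      finally show ?thesis using \<open>1 \<le> \<Phi> D\<close> \<Phi>C by (simp add: f_def)
    qed
    let ?E = "measure_pmf.expectation (pzf_round G)"
    have "?E (\<lambda>x. f (blue_step G x C)) \<le> ?E (\<lambda>x. f C + (\<Phi> (blue_step G x C) - \<Phi> C) / (\<delta> * \<Phi> C))"
      using C by (intro integral_mono tangent blue_step_subset_verts) auto
    also have "\<dots> = f C + (?E (\<lambda>x. \<Phi> (blue_step G x C)) - \<Phi> C) / (\<delta> * \<Phi> C)"
      by simp
    also have "\<dots> \<le> f C + (- \<delta> * \<Phi> C) / (\<delta> * \<Phi> C)"
      using drift[OF C] \<delta> \<Phi>C by (intro add_left_mono divide_right_mono) (auto simp: algebra_simps)
    also have "\<dots> = f C - 1" using \<delta> \<Phi>C by simp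
    finally have E: "1 + ?E (\<lambda>x. f (blue_step G x C)) \<le> f C" by simp
    have nn: "0 \<le> f (blue_step G x C)" for x
      using C by (intro f_nonneg blue_step_subset_verts) auto
    have "(\<integral>\<^sup>+ x. ennreal (f (blue_step G x C)) \<partial>pzf_round G) = ennreal (?E (\<lambda>x. f (blue_step G x C)))"
      using nn by (intro nn_integral_eq_integral) auto
    then have "1 + (\<integral>\<^sup>+ x. ennreal (f (blue_step G x C)) \<partial>pzf_round G)
        = ennreal (1 + ?E (\<lambda>x. f (blue_step G x C)))"
      using nn by (simp add: ennreal_plus flip: ennreal_1)
    then show "1 + (\<integral>\<^sup>+ x. ennreal (f (blue_step G x C)) \<partial>pzf_round G) \<le> ennreal (f C)"
      using E by (simp add: ennreal_leI)
  qed
  also have "\<dots> \<le> ennreal ((1 + ln (\<Phi> B)) / \<delta>)"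
    using \<delta> by (intro ennreal_leI) (simp add: f_def)
  finally show ?thesis .
qed

lemma nn_integral_blue_le_power:
  fixes h :: "'a set \<Rightarrow> ennreal"
  assumes "B \<subseteq> verts G"
    and step: "\<And>C. C \<subseteq> verts G \<Longrightarrow> (\<integral>\<^sup>+ x. h (blue_step G x C) \<partial>pzf_round G) \<le> r * h C"
  shows "(\<integral>\<^sup>+ \<omega>. h (blue G B \<omega> t) \<partial>pzf_space G) \<le> r ^ t * h B"
  using assms(1)
proof (induction t arbitrary: B)
  case 0
  then show ?case by (simp add: emeasure_space_pzf_space)
next
  case (Suc t)
  have "(\<integral>\<^sup>+ \<omega>. h (blue G B \<omega> (Suc t)) \<partial>pzf_space G)
      \<le> (\<integral>\<^sup>+ x. r ^ t * h (blue_step G x B) \<partial>pzf_round G)"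
    unfolding nn_integral_blue_Suc[OF Suc.prems]
    by (intro nn_integral_mono Suc.IH blue_step_subset_verts Suc.prems)
  also have "\<dots> = r ^ t * (\<integral>\<^sup>+ x. h (blue_step G x B) \<partial>pzf_round G)"
    by (simp add: nn_integral_cmult)
  also have "\<dots> \<le> r ^ t * (r * h B)"
    by (intro mult_left_mono step Suc.prems) auto
  finally show ?case by (simp add: mult_ac)
qed

text \<open>Markov's inequality for \<open>h\<close> at time \<open>t\<close>: the graph is fully
  blue by then with probability at most 1/2, and otherwise the propagation time is at least
  \<open>Suc t\<close>.\<close>

lemma ept_from_ge_growth:
  fixes h :: "'a set \<Rightarrow> real"
  assumes B: "B \<subseteq> verts G"
    and h: "\<And>C. C \<subseteq> verts G \<Longrightarrow> 0 \<le> h C" and r: "0 \<le> r"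
    and step: "\<And>C. C \<subseteq> verts G \<Longrightarrow>
      measure_pmf.expectation (pzf_round G) (\<lambda>x. h (blue_step G x C)) \<le> r * h C"
    and half: "2 * r ^ t * h B \<le> h (verts G)" and full: "0 < h (verts G)"
  shows "ennreal (real (Suc t) / 2) \<le> ept_from G B"
proof -
  interpret P: prob_space "pzf_space G"
    by (rule prob_space_pzf_space)
  let ?full = "{\<omega> \<in> space (pzf_space G). blue G B \<omega> t = verts G}"
  have meas: "?full \<in> sets (pzf_space G)"
    using measurable_sets[OF measurable_blue[OF B, of t], of "{verts G}"]
    by (simp add: vimage_def Collect_conj_eq Int_commute)
  have "ennreal (h (verts G)) * emeasure (pzf_space G) ?full
      = (\<integral>\<^sup>+ \<omega>. ennreal (h (verts G)) * indicator ?full \<omega> \<partial>pzf_space G)"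
    using meas by (simp add: nn_integral_cmult_indicator)
  also have "\<dots> \<le> (\<integral>\<^sup>+ \<omega>. ennreal (h (blue G B \<omega> t)) \<partial>pzf_space G)"
    by (rule nn_integral_mono) (simp split: split_indicator)
  also have "\<dots> \<le> ennreal r ^ t * ennreal (h B)"
  proof (rule nn_integral_blue_le_power[OF B])
    fix C assume C: "C \<subseteq> verts G"
    have "(\<integral>\<^sup>+ x. ennreal (h (blue_step G x C)) \<partial>pzf_round G)
        = ennreal (measure_pmf.expectation (pzf_round G) (\<lambda>x. h (blue_step G x C)))"
      using C by (intro nn_integral_eq_integral) (simp_all add: h blue_step_subset_verts)
    also have "\<dots> \<le> ennreal (r * h C)" by (intro ennreal_leI step C)
    also have "\<dots> = ennreal r * ennreal (h C)" using h[OF C] r by (simp add: ennreal_mult)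
    finally show "(\<integral>\<^sup>+ x. ennreal (h (blue_step G x C)) \<partial>pzf_round G) \<le> ennreal r * ennreal (h C)" .
  qed
  also have "\<dots> = ennreal (r ^ t * h B)" using r h[OF B] by (simp add: ennreal_mult ennreal_power)
  also have "\<dots> \<le> ennreal (h (verts G) / 2)" using half by (intro ennreal_leI) simp
  finally have "h (verts G) * P.prob ?full \<le> h (verts G) / 2"
    using full by (simp add: P.emeasure_eq_measure flip: ennreal_mult)
  then have "P.prob ?full \<le> 1 / 2" using full by (simp add: field_simps)
  then have prob: "1 / 2 \<le> P.prob (space (pzf_space G) - ?full)"
    using P.prob_compl[OF meas] by simp
  have "ennreal (real (Suc t) / 2) = ennreal (real (Suc t) * (1 / 2))" by simp
  also have "\<dots> \<le> ennreal (real (Suc t) * P.prob (space (pzf_space G) - ?full))"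
    using prob by (intro ennreal_leI mult_left_mono) auto
  also have "\<dots> = of_nat (Suc t) * emeasure (pzf_space G) (space (pzf_space G) - ?full)"
    by (simp only: P.emeasure_eq_measure ennreal_mult measure_nonneg of_nat_0_le_iff
        ennreal_of_nat_eq_real_of_nat)
  also have "\<dots> = (\<integral>\<^sup>+ \<omega>. of_nat (Suc t) * indicator (space (pzf_space G) - ?full) \<omega> \<partial>pzf_space G)"
    using meas by (subst nn_integral_cmult_indicator) auto
  also have "\<dots> \<le> ept_from G B"
    unfolding ept_from_def
  proof (rule nn_integral_mono)
    fix \<omega>
    show "of_nat (Suc t) * indicator (space (pzf_space G) - ?full) \<omega> \<le> pt_pzf G B \<omega>"
      using pt_pzf_ge[of B \<omega> t]
      by (cases "\<omega> \<in> space (pzf_space G) - ?full") (simp_all del: of_nat_Suc)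
  qed
  finally show ?thesis .
qed

end

section \<open>Joint law of the trials within one round\<close>

context graph
begin

text \<open>Independence in product form. A general \<open>g\<close> covers both joint success
  (\<open>of_bool\<close>) and joint failure (its negation).\<close>

lemma expectation_prod_attempts:
  fixes g :: "bool \<Rightarrow> real"
  assumes C: "C \<subseteq> verts G" and S: "S \<subseteq> attempts G C" and g: "\<And>b. 0 \<le> g b"
  shows "measure_pmf.expectation (pzf_round G) (\<lambda>x. \<Prod>e\<in>S. g (x (C, e)))
    = (\<Prod>(u, w)\<in>S. force_prob G C u * g True + (1 - force_prob G C u) * g False)"
proof -
  let ?I = "SIGMA C : Pow (verts G). attempts G C"
  let ?p = "\<lambda>(C, u, w). bernoulli_pmf (force_prob G C u)"
  \<comment> \<open>Padding with the factor 1 outside \<open>S\<close> turns the product into one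
    over the whole index set of \<open>pzf_round\<close>, where the expectation factorizes.\<close>
  define f where "f i v = (if i \<in> Pair C ` S then g v else 1)" for i v
  have sub: "Pair C ` S \<subseteq> ?I" using C S by auto
  have "(\<Prod>i\<in>?I. f i (x i)) = (\<Prod>e\<in>S. g (x (C, e)))" for x
  proof -
    have "(\<Prod>i\<in>?I. f i (x i)) = (\<Prod>i\<in>Pair C ` S. g (x i))"
      using sub by (intro prod.mono_neutral_cong_right finite_all_attempts) (auto simp: f_def)
    also have "\<dots> = (\<Prod>e\<in>S. g (x (C, e)))" by (subst prod.reindex) (auto simp: inj_on_def)
    finally show ?thesis .
  qed
  then have "measure_pmf.expectation (pzf_round G) (\<lambda>x. \<Prod>e\<in>S. g (x (C, e)))
      = measure_pmf.expectation (pzf_round G) (\<lambda>x. \<Prod>i\<in>?I. f i (x i))"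
    by simp
  also have "\<dots> = (\<Prod>i\<in>?I. measure_pmf.expectation (?p i) (f i))"
    unfolding pzf_round_def using g
    by (intro expectation_prod_Pi_pmf finite_all_attempts)
       (auto simp: f_def intro!: integrable_measure_pmf_finite)
  also have "\<dots> = (\<Prod>i\<in>Pair C ` S. measure_pmf.expectation (?p i) g)"
    using sub by (intro prod.mono_neutral_cong_right finite_all_attempts)
      (auto simp: f_def[abs_def])
  also have "\<dots> = (\<Prod>e\<in>S. measure_pmf.expectation (?p (C, e)) g)"
    by (subst prod.reindex) (auto simp: inj_on_def)
  also have "\<dots> = (\<Prod>(u, w)\<in>S. force_prob G C u * g True + (1 - force_prob G C u) * g False)"
    using S force_prob_bounds
    by (intro prod.cong refl) (auto simp: mult.commute dest!: subsetD)
  finally show ?thesis .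
qed

lemma expectation_attempt:
  assumes "C \<subseteq> verts G" "(u, w) \<in> attempts G C"
  shows "measure_pmf.expectation (pzf_round G) (\<lambda>x. of_bool (x (C, u, w))) = force_prob G C u"
  using expectation_prod_attempts[OF assms(1), of "{(u, w)}" of_bool] assms(2) by simp

lemma expectation_attempt_pair:
  assumes "C \<subseteq> verts G" "(u, w) \<in> attempts G C" "(u', w') \<in> attempts G C" "(u, w) \<noteq> (u', w')"
  shows "measure_pmf.expectation (pzf_round G) (\<lambda>x. of_bool (x (C, u, w)) * of_bool (x (C, u', w')))
    = force_prob G C u * force_prob G C u'"
  using expectation_prod_attempts[OF assms(1), of "{(u, w), (u', w')}" of_bool] assms(2-) by simp

end

section \<open>Complete bipartite graphs: one round, then bounds for a given start\<close>

locale complete_bipartition = graph G for G :: "('a, 'b) pre_digraph" (structure) +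
  fixes A B :: "'a set"
  assumes verts_eq: "verts G = A \<union> B" and disjoint: "A \<inter> B = {}"
    and dominates_iff: "u \<rightarrow> w \<longleftrightarrow> u \<in> A \<and> w \<in> B \<or> u \<in> B \<and> w \<in> A"
begin

text \<open>Lets estimates for forces from \<open>A\<close> into \<open>B\<close> be reused in the
  other direction, and lets the smaller part play the role of \<open>A\<close>.\<close>

lemma swap: "complete_bipartition G B A"
  by unfold_locales (use verts_eq disjoint dominates_iff in auto)

lemma finite_parts [simp]: "finite A" "finite B"
  using finite_verts unfolding verts_eq by simp_all

lemma force_prob_part:
  assumes "u \<in> A" "u \<in> C"
  shows "force_prob G C u = (1 + real (card (B \<inter> C))) / real (card B)"
proof -
  have nbrs: "nbrs G u = B"
    using assms disjoint by (auto simp: nbrs_def dominates_iff)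
  have "closed_nbrs G u \<inter> C = insert u (B \<inter> C)"
    using assms by (auto simp: closed_nbrs_def nbrs)
  moreover have "u \<notin> B" using assms disjoint by auto
  ultimately show ?thesis
    by (simp add: force_prob_def out_degree_eq_card_nbrs nbrs)
qed

lemma attempts_iff:
  assumes "w \<in> B"
  shows "(u, w) \<in> attempts G C \<longleftrightarrow> u \<in> A \<inter> C \<and> w \<notin> C"
  using assms disjoint by (auto simp: attempts_def dominates_iff)

text \<open>Second moment argument using the trials of \<open>a\<close> alone. Jensen's inequality
  goes the wrong way for the convex function \<open>1 / (1 + y)\<close>, so it is bounded above by a
  quadratic, whose expectation needs only the first two moments of the number \<open>X\<close> of
  successes.\<close>

lemma expectation_inverse_blue_le:
  assumes C: "C \<subseteq> verts G" and a: "a \<in> A \<inter> C" and B: "B \<noteq> {}"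
  shows "measure_pmf.expectation (pzf_round G)
      (\<lambda>x. 1 / (1 + real (card (B \<inter> blue_step G x C))))
    \<le> (1 - real (card (B - C)) / (4 * real (card B))) / (1 + real (card (B \<inter> C)))"
proof -
  let ?E = "measure_pmf.expectation (pzf_round G)"
  define k where "k = 1 + real (card (B \<inter> C))"
  define p where "p = k / real (card B)"
  define \<mu> where "\<mu> = real (card (B - C)) / real (card B)"
  define X where "X x = (\<Sum>w\<in>B - C. of_bool (x (C, a, w)) :: real)" for x
  have B_pos: "real (card B) > 0" using B by (simp add: card_gt_0_iff)
  have k: "k \<ge> 1" by (simp add: k_def)
  have \<mu>: "0 \<le> \<mu>" "\<mu> \<le> 1"
    using B_pos by (auto simp: \<mu>_def divide_le_eq_1 intro!: card_mono)
  have att: "(a, w) \<in> attempts G C" if "w \<in> B - C" for w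
    using that a attempts_iff by auto
  have p: "force_prob G C a = p"
    using force_prob_part[of a C] a by (simp add: p_def k_def)
  have "?E X = (\<Sum>w\<in>B - C. ?E (\<lambda>x. of_bool (x (C, a, w))))"
    unfolding X_def by (rule Bochner_Integration.integral_sum) simp
  also have "\<dots> = (\<Sum>w\<in>B - C. p)"
    by (intro sum.cong refl) (simp add: expectation_attempt[OF C att] p)
  finally have EX: "?E X = k * \<mu>" by (simp add: p_def \<mu>_def)
  have "?E (\<lambda>x. (X x)\<^sup>2) = ?E (\<lambda>x. \<Sum>w\<in>B - C. \<Sum>w'\<in>B - C. of_bool (x (C, a, w)) * of_bool (x (C, a, w')))"
    by (simp only: X_def power2_eq_square sum_product)
  also have "\<dots> = (\<Sum>w\<in>B - C. \<Sum>w'\<in>B - C. ?E (\<lambda>x. of_bool (x (C, a, w)) * of_bool (x (C, a, w'))))"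
    by (simp only: Bochner_Integration.integral_sum integrable_pzf_round)
  \<comment> \<open>The term \<open>p\<^sup>2\<close> is also granted on the diagonal, where the
    exact value is \<open>p\<close>, so that the double sum has a closed form.\<close>
  also have "\<dots> \<le> (\<Sum>w\<in>B - C. \<Sum>w'\<in>B - C. (if w = w' then p else 0) + p\<^sup>2)"
  proof (intro sum_mono)
    fix w w' assume w: "w \<in> B - C" "w' \<in> B - C"
    show "?E (\<lambda>x. of_bool (x (C, a, w)) * of_bool (x (C, a, w'))) \<le> (if w = w' then p else 0) + p\<^sup>2"
    proof (cases "w = w'")
      case True
      then show ?thesis
        using expectation_attempt[OF C att[OF w(1)]] by (simp add: p flip: of_bool_conj)
    next
      case False
      then show ?thesis
        using expectation_attempt_pair[OF C att[OF w(1)] att[OF w(2)]] by (simp add: p power2_eq_square)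
    qed
  qed
  also have "\<dots> = real (card (B - C)) * p + (real (card (B - C)))\<^sup>2 * p\<^sup>2"
    by (simp add: sum.distrib power2_eq_square distrib_left)
  also have "\<dots> = k * \<mu> + k\<^sup>2 * \<mu>\<^sup>2"
    by (simp add: p_def \<mu>_def power2_eq_square mult_ac)
  \<comment> \<open>Uses \<open>k \<le> k\<^sup>2\<close> and
    \<open>\<mu>\<^sup>2 \<le> \<mu>\<close>, so that both terms become proportional to
    \<open>\<mu>\<close>.\<close>
  also have "\<dots> \<le> k\<^sup>2 * \<mu> + k\<^sup>2 * \<mu>"
    using k \<mu> by (intro add_mono mult_right_mono mult_left_mono)
      (auto simp: power2_eq_square mult_le_cancel_left1 intro: mult_left_le)
  finally have EX2: "?E (\<lambda>x. (X x)\<^sup>2) \<le> 2 * k\<^sup>2 * \<mu>" by (simp add: mult_ac)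
  have "1 / (1 + real (card (B \<inter> blue_step G x C)))
      \<le> 1 / k - 3 / (4 * k\<^sup>2) * X x + 1 / (4 * k ^ 3) * (X x)\<^sup>2" for x
  proof -
    let ?F = "{w \<in> B - C. x (C, a, w)}"
    define y where "y = X x / k"
    have X: "X x = real (card ?F)"
      by (simp add: X_def sum.If_cases of_bool_def Int_def)
    then have y: "y \<ge> 0" using k by (simp add: y_def)
    have "card (B \<inter> C) + card ?F = card ((B \<inter> C) \<union> ?F)"
      by (rule card_Un_disjoint[symmetric]) auto
    also have "\<dots> \<le> card (B \<inter> blue_step G x C)"
      using att by (intro card_mono) (auto simp: blue_step_def)
    finally have "k * (1 + y) \<le> 1 + real (card (B \<inter> blue_step G x C))"
      using X k by (simp add: k_def y_def distrib_left)
    moreover have "0 < k * (1 + y)" using k y by simp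
    ultimately have "1 / (1 + real (card (B \<inter> blue_step G x C))) \<le> 1 / (k * (1 + y))"
      by (intro divide_left_mono) auto
    \<comment> \<open>The quadratic meets \<open>1 / (1 + y)\<close> at \<open>y = 0\<close> and
      touches it at \<open>y = 1\<close>, the point where \<open>1 + j\<close> has doubled.\<close>
    also have "1 / (1 + y) \<le> 1 - 3 / 4 * y + 1 / 4 * y\<^sup>2"
    proof -
      have "(1 - 3 / 4 * y + 1 / 4 * y\<^sup>2) * (1 + y) = 1 + y / 4 * (1 - y)\<^sup>2"
        by (simp add: power2_eq_square field_simps)
      also have "\<dots> \<ge> 1" using y by simp
      finally show ?thesis using y by (simp add: pos_divide_le_eq)
    qed
    then have "1 / (k * (1 + y)) \<le> (1 - 3 / 4 * y + 1 / 4 * y\<^sup>2) / k"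
      using k divide_right_mono[of "1 / (1 + y)" _ k] by (simp add: mult.commute)
    also have "\<dots> = 1 / k - 3 / (4 * k\<^sup>2) * X x + 1 / (4 * k ^ 3) * (X x)\<^sup>2"
      using k by (simp add: y_def field_simps power2_eq_square power3_eq_cube)
    finally show ?thesis .
  qed
  then have "?E (\<lambda>x. 1 / (1 + real (card (B \<inter> blue_step G x C))))
      \<le> ?E (\<lambda>x. 1 / k - 3 / (4 * k\<^sup>2) * X x + 1 / (4 * k ^ 3) * (X x)\<^sup>2)"
    by (intro integral_mono) auto
  also have "\<dots> = 1 / k - 3 / (4 * k\<^sup>2) * ?E X + 1 / (4 * k ^ 3) * ?E (\<lambda>x. (X x)\<^sup>2)"
    by simp
  \<comment> \<open>The linear term contributes \<open>- 3 / 4 * \<mu>\<close> and the quadratic one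
    at most \<open>2 / 4 * \<mu>\<close>, both over \<open>k\<close>; the gain
    \<open>\<mu> / 4\<close> remains.\<close>
  also have "\<dots> \<le> 1 / k - 3 / (4 * k\<^sup>2) * (k * \<mu>) + 1 / (4 * k ^ 3) * (2 * k\<^sup>2 * \<mu>)"
    unfolding EX using EX2 k by (intro add_left_mono mult_left_mono) auto
  also have "\<dots> = (1 - \<mu> / 4) / k"
    using k by (simp add: field_simps power2_eq_square power3_eq_cube)
  finally show ?thesis by (simp add: \<mu>_def k_def mult.commute)
qed

text \<open>Union bound: with \<open>k = 1 + card (B \<inter> C)\<close>, each blue vertex of
  \<open>A\<close> makes on average \<open>card (B - C) * k / card B \<le> k\<close> successful
  forces, and there are at most \<open>card A\<close> such vertices.\<close>

lemma expectation_blue_le: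
  assumes C: "C \<subseteq> verts G"
  shows "measure_pmf.expectation (pzf_round G) (\<lambda>x. 1 + real (card (B \<inter> blue_step G x C)))
    \<le> (1 + real (card A)) * (1 + real (card (B \<inter> C)))"
proof (cases "B = {}")
  case True
  then show ?thesis by simp
next
  case False
  let ?E = "measure_pmf.expectation (pzf_round G)"
  define k where "k = 1 + real (card (B \<inter> C))"
  have B_pos: "real (card B) > 0" using False by (simp add: card_gt_0_iff)
  let ?R = "\<lambda>x. \<Sum>w\<in>B - C. \<Sum>u\<in>A \<inter> C. of_bool (x (C, u, w)) :: real"
  have "1 + real (card (B \<inter> blue_step G x C)) \<le> k + ?R x" for x
  proof -
    let ?F = "\<Union>u\<in>A \<inter> C. {w \<in> B - C. x (C, u, w)}"
    have "card (B \<inter> blue_step G x C) \<le> card ((B \<inter> C) \<union> ?F)"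
      by (intro card_mono) (auto simp: blue_step_def attempts_iff)
    also have "\<dots> \<le> card (B \<inter> C) + (\<Sum>u\<in>A \<inter> C. card {w \<in> B - C. x (C, u, w)})"
      by (intro order_trans[OF card_Un_le] add_left_mono card_UN_le) simp
    finally have "1 + real (card (B \<inter> blue_step G x C))
        \<le> k + (\<Sum>u\<in>A \<inter> C. real (card {w \<in> B - C. x (C, u, w)}))"
      unfolding k_def by (simp flip: of_nat_sum of_nat_add)
    also have "(\<Sum>u\<in>A \<inter> C. real (card {w \<in> B - C. x (C, u, w)})) = ?R x"
      by (subst sum.swap) (simp add: sum.If_cases of_bool_def Int_def)
    finally show ?thesis .
  qed
  then have "?E (\<lambda>x. 1 + real (card (B \<inter> blue_step G x C))) \<le> ?E (\<lambda>x. k + ?R x)"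
    by (intro integral_mono) auto
  also have "\<dots> = k + (\<Sum>w\<in>B - C. \<Sum>u\<in>A \<inter> C. ?E (\<lambda>x. of_bool (x (C, u, w))))"
    by (subst Bochner_Integration.integral_add, simp, simp,
        (subst Bochner_Integration.integral_sum, simp)+) simp
  also have "(\<Sum>w\<in>B - C. \<Sum>u\<in>A \<inter> C. ?E (\<lambda>x. of_bool (x (C, u, w))))
      = (\<Sum>w\<in>B - C. \<Sum>u\<in>A \<inter> C. k / real (card B))"
    by (intro sum.cong refl, subst expectation_attempt[OF C])
       (auto simp: attempts_iff force_prob_part k_def)
  also have "\<dots> = k * real (card (A \<inter> C)) * (real (card (B - C)) / real (card B))" by simp
  also have "\<dots> \<le> k * real (card A) * 1"
    using B_pos by (intro mult_mono) (auto simp: k_def divide_le_eq_1 intro!: card_mono)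
  finally show ?thesis by (simp add: k_def algebra_simps)
qed

text \<open>A white vertex of \<open>A\<close> survives only if the trials from all of
  \<open>B\<close> fail. Each succeeds with probability at least \<open>1 / card A\<close>, since a
  forcing vertex counts itself, so survival has probability at most
  \<open>exp (- card B / card A) \<le> exp (- 1)\<close>.\<close>

lemma expectation_white_le_half:
  assumes C: "C \<subseteq> verts G" and a: "A \<inter> C \<noteq> {}" and B: "B \<subseteq> C" and le: "card A \<le> card B"
  shows "measure_pmf.expectation (pzf_round G) (\<lambda>x. real (card (A - blue_step G x C)))
    \<le> real (card (A - C)) / 2"
proof -
  interpret swap: complete_bipartition G B A by (rule swap)
  let ?E = "measure_pmf.expectation (pzf_round G)"
  let ?miss = "\<lambda>v x. \<Prod>e\<in>B \<times> {v}. of_bool (\<not> x (C, e)) :: real"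
  have "A \<noteq> {}" using a by auto
  then have A_pos: "real (card A) > 0" by (simp add: card_gt_0_iff)
  have att: "B \<times> {v} \<subseteq> attempts G C" if "v \<in> A - C" for v
    using that B by (auto simp: swap.attempts_iff)
  have "real (card (A - blue_step G x C)) \<le> (\<Sum>v\<in>A - C. ?miss v x)" for x
  proof -
    have "real (card (A - blue_step G x C)) = (\<Sum>v\<in>A - blue_step G x C. 1)" by simp
    also have "\<dots> = (\<Sum>v\<in>A - blue_step G x C. ?miss v x)"
    proof (rule sum.cong[OF refl])
      fix v assume v: "v \<in> A - blue_step G x C"
      then have "\<not> x (C, e)" if "e \<in> B \<times> {v}" for e
        using that att[of v] by (auto simp: blue_step_def)
      then show "1 = ?miss v x" by (intro prod.neutral[symmetric]) auto
    qed
    also have "\<dots> \<le> (\<Sum>v\<in>A - C. ?miss v x)"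
      by (rule sum_mono2) (auto simp: blue_step_def intro!: prod_nonneg)
    finally show ?thesis .
  qed
  then have "?E (\<lambda>x. real (card (A - blue_step G x C))) \<le> ?E (\<lambda>x. \<Sum>v\<in>A - C. ?miss v x)"
    by (intro integral_mono) auto
  also have "\<dots> = (\<Sum>v\<in>A - C. ?E (?miss v))"
    by (rule Bochner_Integration.integral_sum) simp
  also have "\<dots> \<le> (\<Sum>v\<in>A - C. 1 / 2)"
  proof (rule sum_mono)
    fix v assume v: "v \<in> A - C"
    define q where "q = 1 - (1 + real (card (A \<inter> C))) / real (card A)"
    have "B \<noteq> {}" using le A_pos by auto
    then obtain b where b: "b \<in> B" by auto
    have q: "1 - force_prob G C u = q" if "u \<in> B" for u
      using swap.force_prob_part[of u C] that B by (auto simp: q_def)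
    have "?E (?miss v) = (\<Prod>(u, w)\<in>B \<times> {v}. 1 - force_prob G C u)"
      using expectation_prod_attempts[OF C att[OF v], of "\<lambda>b. of_bool (\<not> b)"] by simp
    also have "\<dots> = (\<Prod>(u, w)\<in>B \<times> {v}. q)"
      by (intro prod.cong refl) (auto simp: q)
    also have "\<dots> = q ^ card B" by (simp add: card_cartesian_product)
    also have "\<dots> \<le> exp (- 1 / real (card A)) ^ card B"
    proof (rule power_mono)
      \<comment> \<open>Nonnegativity comes from \<open>force_prob \<le> 1\<close>, valid because
        \<open>b\<close> really has the white neighbor \<open>v\<close>.\<close>
      show "0 \<le> q" using q[OF b] force_prob_bounds(2)[of b v C] att[OF v] b by auto
      have "q \<le> 1 + (- 1 / real (card A))" by (simp add: q_def add_divide_distrib)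
      also have "\<dots> \<le> exp (- 1 / real (card A))" by (rule exp_ge_add_one_self)
      finally show "q \<le> exp (- 1 / real (card A))" .
    qed
    also have "\<dots> = exp (- (real (card B) / real (card A)))" by (simp flip: exp_of_nat_mult)
    also have "\<dots> \<le> exp (- 1)"
      using le A_pos by (simp add: pos_le_divide_eq)
    also have "\<dots> \<le> 1 / 2"
      using exp_ge_add_one_self[of 1] by (simp add: exp_minus field_simps)
    finally show "?E (?miss v) \<le> 1 / 2" .
  qed
  finally show ?thesis by simp
qed

lemma ept_from_le_ln:
  assumes le: "card A \<le> card B" and a: "a \<in> A"
  shows "ept_from G {a} \<le> ennreal (40 * ln (real (card A + card B)))"
proof -
  let ?E = "measure_pmf.expectation (pzf_round G)"
  define m n where "m = real (card A)" and "n = real (card B)"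
  have "A \<noteq> {}" using a by auto
  then have m: "m \<ge> 1" by (simp add: m_def Suc_le_eq card_gt_0_iff)
  have mn: "m \<le> n" using le by (simp add: m_def n_def)
  have B: "B \<noteq> {}" using m mn by (auto simp: n_def)
  define \<Psi> where "\<Psi> C = (n + 1) * real (card (B - C)) / (1 + real (card (B \<inter> C)))" for C
  \<comment> \<open>The weight \<open>m\<close> makes \<open>m * \<Psi> C\<close> at least the
    number of white vertices in \<open>A\<close> while \<open>B\<close> is not yet blue. That number
    need not shrink in this phase and is absorbed by the decrease of \<open>\<Psi>\<close>.\<close>
  define \<Phi> where "\<Phi> C = m * \<Psi> C + real (card (A - C))" for C
  have card_B: "real (card (B - C)) = n - real (card (B \<inter> C))" for C
    using card_Diff_subset_Int[of B C] card_mono[of B "B \<inter> C"] by (simp add: n_def of_nat_diff)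
  \<comment> \<open>\<open>\<Psi>\<close> is affine in \<open>1 / (1 + j)\<close>, so the bound on
    the expected reciprocal carries over.\<close>
  have \<Psi>_alt: "\<Psi> C = (n + 1)\<^sup>2 * (1 / (1 + real (card (B \<inter> C)))) - (n + 1)" for C
    unfolding \<Psi>_def card_B by (simp add: field_simps power2_eq_square)
  have \<Psi>_ge: "1 \<le> \<Psi> C" if "\<not> B \<subseteq> C" for C
  proof -
    have "card (B - C) \<noteq> 0" using that by simp
    then have w: "1 \<le> real (card (B - C))" by linarith
    then have "1 + real (card (B \<inter> C)) \<le> (n + 1) * 1" unfolding card_B by simp
    also have "\<dots> \<le> (n + 1) * real (card (B - C))" using w m mn by (intro mult_left_mono) auto
    finally show ?thesis unfolding \<Psi>_def by simp
  qed
  have \<Psi>_0: "\<Psi> C = 0" if "B \<subseteq> C" for C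
  proof -
    have "B - C = {}" using that by auto
    then show ?thesis by (simp add: \<Psi>_def)
  qed
  have \<Psi>_nonneg: "0 \<le> \<Psi> C" for C using m mn by (simp add: \<Psi>_def)
  have \<Phi>_ge: "1 \<le> \<Phi> C" if C: "C \<subset> verts G" for C
  proof (cases "B \<subseteq> C")
    case True
    then have "A - C \<noteq> {}" using C verts_eq by auto
    then have "card (A - C) \<noteq> 0" by simp
    then have "1 \<le> real (card (A - C))" by linarith
    then show ?thesis using \<Psi>_nonneg[of C] m by (simp add: \<Phi>_def add_increasing)
  next
    case False
    then have "1 * 1 \<le> m * \<Psi> C" using \<Psi>_ge[of C] m by (intro mult_mono) auto
    then show ?thesis by (simp add: \<Phi>_def)
  qed
  have \<Phi>_verts: "\<Phi> (verts G) = 0"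
    by (simp add: \<Phi>_def \<Psi>_0 verts_eq)
  have \<Phi>_drift: "?E (\<lambda>x. \<Phi> (blue_step G x C)) \<le> (1 - 1 / 8) * \<Phi> C"
    if C: "{a} \<subseteq> C" "C \<subset> verts G" for C
  proof -
    have E: "?E (\<lambda>x. \<Phi> (blue_step G x C))
        = m * ?E (\<lambda>x. \<Psi> (blue_step G x C)) + ?E (\<lambda>x. real (card (A - blue_step G x C)))"
      by (simp add: \<Phi>_def)
    show ?thesis
    proof (cases "B \<subseteq> C")
      case True
      have "\<Psi> (blue_step G x C) = 0" for x
        using True by (intro \<Psi>_0) (auto simp: blue_step_def)
      moreover have "?E (\<lambda>x. real (card (A - blue_step G x C))) \<le> real (card (A - C)) / 2"
        using C a True le by (intro expectation_white_le_half) auto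
      ultimately show ?thesis
        unfolding E by (simp add: \<Phi>_def \<Psi>_0[OF True])
    next
      case False
      let ?k = "1 + real (card (B \<inter> C))"
      have "?E (\<lambda>x. \<Psi> (blue_step G x C))
          = (n + 1)\<^sup>2 * ?E (\<lambda>x. 1 / (1 + real (card (B \<inter> blue_step G x C)))) - (n + 1)"
        unfolding \<Psi>_alt by (simp del: times_divide_eq_right)
      also have "\<dots> \<le> (n + 1)\<^sup>2 * ((1 - real (card (B - C)) / (4 * n)) / ?k) - (n + 1)"
        using expectation_inverse_blue_le[of C a] C a B
        by (intro diff_right_mono mult_left_mono) (auto simp: n_def)
      also have "\<dots> = \<Psi> C - (n + 1) / n * (\<Psi> C / 4)"
      proof -
        have "\<Psi> C / 4 * (n + 1) / n = (n + 1)\<^sup>2 * (real (card (B - C)) / (4 * n)) / ?k"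
          by (simp only: \<Psi>_def power2_eq_square times_divide_eq_left times_divide_eq_right
              divide_divide_eq_left mult_ac)
        then show ?thesis
          unfolding \<Psi>_alt[of C] by (simp add: diff_divide_distrib right_diff_distrib mult_ac)
      qed
      also have "\<dots> \<le> \<Psi> C - 1 * (\<Psi> C / 4)"
        using m mn \<Psi>_nonneg[of C] by (intro diff_left_mono mult_right_mono) auto
      finally have 1: "?E (\<lambda>x. \<Psi> (blue_step G x C)) \<le> 3 / 4 * \<Psi> C" by simp
      have "?E (\<lambda>x. real (card (A - blue_step G x C))) \<le> ?E (\<lambda>x. real (card (A - C)))"
        by (intro integral_mono) (auto simp: blue_step_def intro!: card_mono)
      then have 2: "?E (\<lambda>x. real (card (A - blue_step G x C))) \<le> real (card (A - C))" by simp
      have "real (card (A - C)) \<le> m * 1" unfolding m_def by (simp add: card_mono)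
      also have "\<dots> \<le> m * \<Psi> C" using \<Psi>_ge[OF False] m by (intro mult_left_mono) auto
      finally have 3: "real (card (A - C)) \<le> m * \<Psi> C" .
      have "?E (\<lambda>x. \<Phi> (blue_step G x C)) \<le> m * (3 / 4 * \<Psi> C) + real (card (A - C))"
        unfolding E using 1 2 m by (intro add_mono mult_left_mono) auto
      \<comment> \<open>Since \<open>7/8 - 3/4 = 1/8\<close>, this amounts to
        \<open>card (A - C) \<le> m * \<Psi> C\<close>.\<close>
      also have "\<dots> \<le> (1 - 1 / 8) * \<Phi> C"
        using 3 by (simp add: \<Phi>_def)
      finally show ?thesis .
    qed
  qed
  have "ept_from G {a} \<le> ennreal ((1 + ln (\<Phi> {a})) / (1 / 8))"
  proof (rule ept_from_le_multiplicative_drift)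
    show "{a} \<subseteq> verts G" using a verts_eq by auto
    show "\<Phi> C = 0 \<or> 1 \<le> \<Phi> C" if "C \<subseteq> verts G" for C
      using \<Phi>_ge[of C] \<Phi>_verts that by (cases "C = verts G") auto
    show "\<Phi> C \<noteq> 0" if "C \<subset> verts G" for C using \<Phi>_ge[OF that] by auto
  qed (use \<Phi>_drift in auto)
  also have "\<dots> \<le> ennreal (40 * ln (real (card A + card B)))"
  proof (rule ennreal_leI)
    have a': "a \<notin> B" using a disjoint by auto
    have sub: "{a} \<subset> verts G" using B a a' verts_eq by auto
    have "\<Psi> {a} = (n + 1) * n" using a' by (simp add: \<Psi>_def n_def)
    then have "\<Phi> {a} \<le> m * ((n + 1) * n) + m"
      unfolding \<Phi>_def m_def by (simp add: card_mono)
    also have "\<dots> \<le> (m + n) ^ 3"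
    proof -
      have "m * 1 \<le> m * n\<^sup>2" "m * n * 1 \<le> m * n * n"
        using m mn by (intro mult_left_mono; simp)+
      moreover have "0 \<le> m ^ 3" "0 \<le> n ^ 3" "0 \<le> m * m * n" using m mn by auto
      ultimately show ?thesis
        by (simp add: power3_eq_cube power2_eq_square algebra_simps)
    qed
    finally have "ln (\<Phi> {a}) \<le> ln ((m + n) ^ 3)"
      using \<Phi>_ge[OF sub] by (intro ln_mono) auto
    then have "ln (\<Phi> {a}) \<le> 3 * ln (m + n)" using m mn by (simp add: ln_realpow)
    \<comment> \<open>With \<open>L = ln (m + n)\<close>, this gives \<open>1 \<le> 2 * L\<close>,
      hence \<open>8 * (1 + 3 * L) \<le> 40 * L\<close>.\<close>
    moreover have "1 / 2 \<le> ln (m + n)"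
    proof -
      have "1 / 2 \<le> ln (2 :: real)" using ln_le_minus_one[of "1 / 2 :: real"] by (simp add: ln_div)
      also have "\<dots> \<le> ln (m + n)" using m mn by (intro ln_mono) auto
      finally show ?thesis .
    qed
    ultimately show "(1 + ln (\<Phi> {a})) / (1 / 8) \<le> 40 * ln (real (card A + card B))"
      by (simp add: m_def n_def)
  qed
  finally show ?thesis .
qed

text \<open>Growth bound with \<open>h = 1 + j\<close> and ratio \<open>r = 1 + card A\<close>; any
  start has \<open>j \<le> 1\<close>, whichever part contains \<open>v\<close>.\<close>

lemma ept_from_ge_ln:
  assumes A: "A \<noteq> {}" and n: "16 \<le> card B" and v: "v \<in> verts G"
  shows "ennreal (ln (real (card B)) / (4 * ln (1 + real (card A)))) \<le> ept_from G {v}"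
proof -
  define r n where "r = 1 + real (card A)" and "n = real (card B)"
  have r: "r > 1" using A by (simp add: r_def card_gt_0_iff)
  have n: "16 \<le> n" using assms(2) by (simp add: n_def)
  \<comment> \<open>The 4 consists of a factor 2 from Markov's inequality and a factor 2 from the
    initial value \<open>1 + j \<le> 2\<close>.\<close>
  define t where "t = nat \<lfloor>log r (n / 4)\<rfloor>"
  have log_nonneg: "0 \<le> log r (n / 4)" using r n by simp
  have "r ^ t = r powr real t" using r by (simp add: powr_realpow)
  also have "\<dots> \<le> r powr log r (n / 4)"
    using r log_nonneg by (intro powr_mono) (auto simp: t_def)
  also have "\<dots> = n / 4" using r n by simp
  finally have t: "r ^ t \<le> n / 4" .
  have "ln n / (4 * ln r) \<le> real (Suc t) / 2"
  proof -
    \<comment> \<open>For \<open>n \<ge> 16\<close>, \<open>n / 4\<close> is at least the square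
      root of \<open>n\<close>, so dividing by 4 at most halves the logarithm.\<close>
    have "ln (16 :: real) = 2 * ln 4" using ln_realpow[of 4 2] by simp
    moreover have "ln 16 \<le> ln n" using n by (intro ln_mono) auto
    ultimately have "ln n \<le> 2 * ln (n / 4)" using n by (simp add: ln_div)
    then have "ln n / (4 * ln r) \<le> 2 * ln (n / 4) / (4 * ln r)"
      using r by (intro divide_right_mono) auto
    also have "\<dots> = log r (n / 4) / 2" by (simp add: log_def)
    also have "log r (n / 4) \<le> real (Suc t)" unfolding t_def by linarith
    finally show ?thesis by simp
  qed
  then have "ennreal (ln n / (4 * ln r)) \<le> ennreal (real (Suc t) / 2)" by (rule ennreal_leI)
  also have "\<dots> \<le> ept_from G {v}"
  proof (rule ept_from_ge_growth[where h = "\<lambda>C. 1 + real (card (B \<inter> C))" and r = r])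
    have "real (card (B \<inter> {v})) \<le> 1" using card_mono[of "{v}" "B \<inter> {v}"] by auto
    then have "2 * r ^ t * (1 + real (card (B \<inter> {v}))) \<le> 2 * (n / 4) * (1 + 1)"
      using t r n by (intro mult_mono) auto
    also have "\<dots> \<le> 1 + real (card (B \<inter> verts G))"
      using verts_eq by (simp add: n_def Int_absorb2)
    finally show "2 * r ^ t * (1 + real (card (B \<inter> {v}))) \<le> 1 + real (card (B \<inter> verts G))" .
  qed (use v r expectation_blue_le in \<open>auto simp: r_def\<close>)
  finally show ?thesis by (simp add: r_def n_def)
qed

end

section \<open>Transfer to the concrete graphs and conclusion\<close>

lemma complete_bipartition_complete_bipartite:
  "complete_bipartition (complete_bipartite m n) (Inl ` {..<m}) (Inr ` {..<n})"
proof -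
  interpret graph "complete_bipartite m n"
    using complete_bipartite_digraph_complete_bipartite[of m n]
    by (simp add: complete_bipartite_digraph_def)
  show ?thesis
    by unfold_locales (auto simp: complete_bipartite_def Let_def)
qed

lemma ept_le:
  assumes "fin_digraph G" "v \<in> verts G"
  shows "ept G \<le> ept_from G {v}"
  unfolding ept_def using assms by (simp add: fin_digraph.finite_verts)

text \<open>\<open>ept\<close> is a minimum over starts, so it suffices to start in the part that is
  not larger.\<close>

lemma ept_complete_bipartite_le:
  assumes "m \<ge> 1" "n \<ge> 1"
  shows "ept (complete_bipartite m n) \<le> ennreal (40 * ln (real (m + n)))"
proof -
  let ?G = "complete_bipartite m n" and ?A = "Inl ` {..<m} :: (nat + nat) set"
    and ?B = "Inr ` {..<n} :: (nat + nat) set"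
  interpret complete_bipartition ?G ?A ?B
    by (rule complete_bipartition_complete_bipartite)
  interpret swap: complete_bipartition ?G ?B ?A by (rule swap)
  have card: "card ?A = m" "card ?B = n" by (simp_all add: card_image)
  show ?thesis
  proof (cases "m \<le> n")
    case True
    have 0: "Inl 0 \<in> ?A" using assms by simp
    have "ept ?G \<le> ept_from ?G {Inl 0}"
      using 0 verts_eq by (intro ept_le fin_digraph_axioms) auto
    also have "\<dots> \<le> ennreal (40 * ln (real (card ?A + card ?B)))"
      by (rule ept_from_le_ln[OF _ 0]) (use True card in simp)
    finally show ?thesis by (simp only: card)
  next
    case False
    have 0: "Inr 0 \<in> ?B" using assms by simp
    have "ept ?G \<le> ept_from ?G {Inr 0}"
      using 0 verts_eq by (intro ept_le fin_digraph_axioms) auto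
    also have "\<dots> \<le> ennreal (40 * ln (real (card ?B + card ?A)))"
      by (rule swap.ept_from_le_ln[OF _ 0]) (use False card in simp)
    finally show ?thesis by (simp only: card add.commute)
  qed
qed

lemma ept_complete_bipartite_ge:
  assumes "c \<ge> 1" "n \<ge> 16"
  shows "ennreal (1 / (4 * ln (1 + real c)) * ln (real n)) \<le> ept (complete_bipartite c n)"
proof -
  interpret complete_bipartition "complete_bipartite c n" "Inl ` {..<c}" "Inr ` {..<n}"
    by (rule complete_bipartition_complete_bipartite)
  have card: "card (Inl ` {..<c} :: (nat + nat) set) = c" "card (Inr ` {..<n} :: (nat + nat) set) = n"
    by (simp_all add: card_image)
  have "verts (complete_bipartite c n) \<noteq> {}" using assms by (auto simp: verts_eq lessThan_empty_iff)
  moreover have "ennreal (1 / (4 * ln (1 + real c)) * ln (real n)) \<le> ept_from (complete_bipartite c n) {v}"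
    if "v \<in> verts (complete_bipartite c n)" for v
    using ept_from_ge_ln[OF _ _ that] assms by (simp add: card lessThan_empty_iff)
  ultimately show ?thesis
    unfolding ept_def by (simp add: Min_ge_iff)
qed

theorem theorem3p3:
  shows "(\<exists>C::real. C > 0 \<and>
            (\<forall>m n::nat. m \<ge> 1 \<and> n \<ge> 1 \<longrightarrow>
               ept (complete_bipartite m n) \<le> ennreal (C * ln (real (m + n)))))
       \<and> (\<forall>c::nat. c \<ge> 1 \<longrightarrow>
            (\<exists>(c1::real) (c2::real) (n0::nat). c1 > 0 \<and> c2 > 0 \<and>
               (\<forall>n\<ge>n0.
                  ennreal (c1 * ln (real n)) \<le> ept (complete_bipartite c n) \<and>
                  ept (complete_bipartite c n) \<le> ennreal (c2 * ln (real n)))))"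
proof (intro conjI allI impI)
  show "\<exists>C::real. C > 0 \<and>
      (\<forall>m n::nat. m \<ge> 1 \<and> n \<ge> 1 \<longrightarrow>
        ept (complete_bipartite m n) \<le> ennreal (C * ln (real (m + n))))"
    by (intro exI[of _ 40]) (simp add: ept_complete_bipartite_le del: of_nat_add)
next
  fix c :: nat assume c: "c \<ge> 1"
  \<comment> \<open>For \<open>n \<ge> c\<close> and \<open>n \<ge> 2\<close>,
    \<open>c + n \<le> n\<^sup>2\<close>, which turns the constant 40 into 80. The threshold 16
    comes from the lower bound.\<close>
  have "ept (complete_bipartite c n) \<le> ennreal (80 * ln (real n))" if n: "n \<ge> max 16 c" for n
  proof -
    have "real (c + n) \<le> 2 * real n" using n by simp
    also have "\<dots> \<le> (real n)\<^sup>2" using n by (simp add: power2_eq_square)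
    finally have "ln (real (c + n)) \<le> ln ((real n)\<^sup>2)" using c by (intro ln_mono) auto
    then have "ln (real (c + n)) \<le> 2 * ln (real n)" using n by (simp add: ln_realpow)
    then have "ennreal (40 * ln (real (c + n))) \<le> ennreal (80 * ln (real n))"
      by (intro ennreal_leI) simp
    with ept_complete_bipartite_le[of c n] c n show ?thesis by (auto intro: order_trans)
  qed
  moreover have "0 < 1 / (4 * ln (1 + real c))" using c by simp
  ultimately show "\<exists>(c1::real) (c2::real) (n0::nat). c1 > 0 \<and> c2 > 0 \<and>
      (\<forall>n\<ge>n0.
        ennreal (c1 * ln (real n)) \<le> ept (complete_bipartite c n) \<and>
        ept (complete_bipartite c n) \<le> ennreal (c2 * ln (real n)))"
    using ept_complete_bipartite_ge[OF c]
    by (intro exI[of _ "1 / (4 * ln (1 + real c))"] exI[of _ 80] exI[of _ "max 16 c"]) auto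
qed

end
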